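(* Let $([0,\tau],\le,+)$ be a truncated ordered abelian group (as defined in the context). Then there exist an ordered abelian group $(\Gamma,\oplus,\le_\Gamma)$, with $P=\{g\in\Gamma: g\ge_\Gamma 0\}$ its semigroup of non-negative elements, and an element $\tau_P\in P$, such that $([0,\tau],+,\le)$ is isomorphic to the structure $([0,\tau_P],+_P,\le_\Gamma)$, where $[0,\tau_P]=\{g\in P: g\le_\Gamma \tau_P\}$ carries the restricted order and the truncated addition $a+_P b=\min(a\oplus b,\tau_P)$.
   Context: A truncated ordered abelian group (TOAG) is a linearly ordered set $([0,\tau],\le)$ with least element $0$ and greatest element $\tau$, together with a binary operation $+$ on $[0,\tau]$, satisfying the following Axioms 1–16 (all variables range over $[0,\tau]$ and are universally quantified). 1. $x+y=y+x$. 2. $x+0=x$. 3. $x+\tau=\tau$. 4. If $x_1\le y_1$ and $x_2\le y_2$ then $x_1+x_2\le y_1+y_2$. 5. $x+(y+z)=(x+y)+z$ (so we write $x+y+z$). 6. If $x+y=x+z<\tau$ then $y=z$. 7. If $x\le y<\tau$, there is a unique $z$ with $x+z=y$; this $z$ is denoted $y\dot{-}x$. 8. For each $x$ there is some $z$ with $x+z=\tau$, and among all such $z$ there is a least one, denoted $\tau\dot{-}x$ (in particular $\tau\dot{-}\tau=0$). 9. $\tau\dot{-}(\tau\dot{-}x)=x$. Convention: an expression $A\dot{-}B$ is only written when $A\ge B$ (it is then defined by Axiom 7 if $A<\tau$ and by Axiom 8 if $A=\tau$). 10. If $x,y<\tau$ and $x+y=\tau$, then $y\dot{-}(\tau\dot{-}x)=x\dot{-}(\tau\dot{-}y)$.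 11. If $y+z<\tau$, $x+(y+z)=\tau$ and $y+x<\tau$, then $x\dot{-}(\tau\dot{-}(y+z))=z\dot{-}(\tau\dot{-}(x+y))$. 12. If $y+z<\tau$, $x+y+z=\tau$, $y+x=\tau$ and $z+(y\dot{-}(\tau\dot{-}x))<\tau$, then $z+(y\dot{-}(\tau\dot{-}x))=x\dot{-}(\tau\dot{-}(y+z))$. 13. If $y+x=\tau$ and $y+z<\tau$, then $z+(y\dot{-}(\tau\dot{-}x))<\tau$. 14. If $y+z=y+x=\tau$ and $z+(y\dot{-}(\tau\dot{-}x))<\tau$, then $x+(y\dot{-}(\tau\dot{-}z))=(x\dot{-}(\tau\dot{-}y))+z$. 15. If $y+z=\tau$, $y+x=\tau$ and $x+(y\dot{-}(\tau\dot{-}z))=\tau$, then $z+(y\dot{-}(\tau\dot{-}x))=\tau$. 16. If $y+z=y+x=x+(y\dot{-}(\tau\dot{-}z))=\tau$, then $(y\dot{-}(\tau\dot{-}x))\dot{-}(\tau\dot{-}z)=(y\dot{-}(\tau\dot{-}z))\dot{-}(\tau\dot{-}x)$. An isomorphism of such structures is an order-preserving bijection preserving the addition. *)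

theory Defs
  imports "HOL-Algebra.Group"
begin

text \<open>
  An order on a carrier is a relation \<open>R\<close> with \<^const>\<open>linear_order_on\<close>, which includes
  \<open>R \<subseteq> T \<times> T\<close>; \<open>(x, y) \<in> R\<close> means that \<open>x\<close> is at most \<open>y\<close>.
\<close>

locale pre_toag =
  fixes T :: "'a set"
    and R :: "('a \<times> 'a) set"
    and add :: "'a \<Rightarrow> 'a \<Rightarrow> 'a"  (infixl \<open>\<boxplus>\<close> 65)
    and zero :: 'a  (\<open>\<zero>\<close>)
    and tau :: 'a  (\<open>\<tau>\<close>)
begin

abbreviation le :: "'a \<Rightarrow> 'a \<Rightarrow> bool"  (infix \<open>\<preceq>\<close> 50)
  where "x \<preceq> y \<equiv> (x, y) \<in> R"

abbreviation lt :: "'a \<Rightarrow> 'a \<Rightarrow> bool"  (infix \<open>\<prec>\<close> 50)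
  where "x \<prec> y \<equiv> (x, y) \<in> R \<and> x \<noteq> y"

text \<open>
  The difference \<open>y \<ominus> x\<close>, meaningful only for \<open>x \<preceq> y\<close>. Below \<open>\<tau>\<close> solutions of
  \<open>x \<boxplus> z = y\<close> are unique (\<open>diff_unique\<close> in the locale \<open>toag\<close>); for \<open>y = \<tau>\<close> they
  are not, and the least one is taken (\<open>diff_tau_least\<close>).
\<close>

definition diff :: "'a \<Rightarrow> 'a \<Rightarrow> 'a"  (infixl \<open>\<ominus>\<close> 65)
  where "y \<ominus> x =
    (if y = \<tau>
     then THE z. z \<in> T \<and> x \<boxplus> z = \<tau> \<and> (\<forall>w\<in>T. x \<boxplus> w = \<tau> \<longrightarrow> z \<preceq> w)
     else THE z. z \<in> T \<and> x \<boxplus> z = y)"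

end

text \<open>
  In \<open>assoc_1\<close> to \<open>assoc_6\<close> the hypotheses, together with the preceding axioms, make every
  difference that occurs meaningful.
\<close>

locale toag = pre_toag T R add zero tau
  for T :: "'a set"
    and R :: "('a \<times> 'a) set"
    and add :: "'a \<Rightarrow> 'a \<Rightarrow> 'a"  (infixl \<open>\<boxplus>\<close> 65)
    and zero :: 'a  (\<open>\<zero>\<close>)
    and tau :: 'a  (\<open>\<tau>\<close>) +
  assumes linear: "linear_order_on T R"
    and zero_closed: "\<zero> \<in> T"
    and zero_least: "x \<in> T \<Longrightarrow> \<zero> \<preceq> x"
    and tau_closed: "\<tau> \<in> T"
    and tau_greatest: "x \<in> T \<Longrightarrow> x \<preceq> \<tau>"
    and add_closed: "\<lbrakk>x \<in> T; y \<in> T\<rbrakk> \<Longrightarrow> x \<boxplus> y \<in> T"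
    and add_commute: "\<lbrakk>x \<in> T; y \<in> T\<rbrakk> \<Longrightarrow> x \<boxplus> y = y \<boxplus> x"
    and add_zero: "x \<in> T \<Longrightarrow> x \<boxplus> \<zero> = x"
    and add_tau: "x \<in> T \<Longrightarrow> x \<boxplus> \<tau> = \<tau>"
    and add_mono: "\<lbrakk>x1 \<in> T; y1 \<in> T; x2 \<in> T; y2 \<in> T; x1 \<preceq> y1; x2 \<preceq> y2\<rbrakk>
      \<Longrightarrow> x1 \<boxplus> x2 \<preceq> y1 \<boxplus> y2"
    and add_assoc: "\<lbrakk>x \<in> T; y \<in> T; z \<in> T\<rbrakk> \<Longrightarrow> x \<boxplus> (y \<boxplus> z) = (x \<boxplus> y) \<boxplus> z"
    and add_cancel: "\<lbrakk>x \<in> T; y \<in> T; z \<in> T; x \<boxplus> y = x \<boxplus> z; x \<boxplus> z \<prec> \<tau>\<rbrakk> \<Longrightarrow> y = z"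
    and diff_unique: "\<lbrakk>x \<in> T; y \<in> T; x \<preceq> y; y \<prec> \<tau>\<rbrakk> \<Longrightarrow> \<exists>!z. z \<in> T \<and> x \<boxplus> z = y"
    and diff_tau_least: "x \<in> T
      \<Longrightarrow> \<exists>z\<in>T. x \<boxplus> z = \<tau> \<and> (\<forall>w\<in>T. x \<boxplus> w = \<tau> \<longrightarrow> z \<preceq> w)"
    and diff_tau_invol: "x \<in> T \<Longrightarrow> \<tau> \<ominus> (\<tau> \<ominus> x) = x"
    and diff_commute: "\<lbrakk>x \<in> T; y \<in> T; x \<prec> \<tau>; y \<prec> \<tau>; x \<boxplus> y = \<tau>\<rbrakk>
      \<Longrightarrow> y \<ominus> (\<tau> \<ominus> x) = x \<ominus> (\<tau> \<ominus> y)"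
    and assoc_1: "\<lbrakk>x \<in> T; y \<in> T; z \<in> T; y \<boxplus> z \<prec> \<tau>; x \<boxplus> (y \<boxplus> z) = \<tau>; y \<boxplus> x \<prec> \<tau>\<rbrakk>
      \<Longrightarrow> x \<ominus> (\<tau> \<ominus> (y \<boxplus> z)) = z \<ominus> (\<tau> \<ominus> (x \<boxplus> y))"
    and assoc_2: "\<lbrakk>x \<in> T; y \<in> T; z \<in> T; y \<boxplus> z \<prec> \<tau>; x \<boxplus> y \<boxplus> z = \<tau>; y \<boxplus> x = \<tau>;
        z \<boxplus> (y \<ominus> (\<tau> \<ominus> x)) \<prec> \<tau>\<rbrakk>
      \<Longrightarrow> z \<boxplus> (y \<ominus> (\<tau> \<ominus> x)) = x \<ominus> (\<tau> \<ominus> (y \<boxplus> z))"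
    and assoc_3: "\<lbrakk>x \<in> T; y \<in> T; z \<in> T; y \<boxplus> x = \<tau>; y \<boxplus> z \<prec> \<tau>\<rbrakk>
      \<Longrightarrow> z \<boxplus> (y \<ominus> (\<tau> \<ominus> x)) \<prec> \<tau>"
    and assoc_4: "\<lbrakk>x \<in> T; y \<in> T; z \<in> T; y \<boxplus> z = \<tau>; y \<boxplus> x = \<tau>;
        z \<boxplus> (y \<ominus> (\<tau> \<ominus> x)) \<prec> \<tau>\<rbrakk>
      \<Longrightarrow> x \<boxplus> (y \<ominus> (\<tau> \<ominus> z)) = (x \<ominus> (\<tau> \<ominus> y)) \<boxplus> z"
    and assoc_5: "\<lbrakk>x \<in> T; y \<in> T; z \<in> T; y \<boxplus> z = \<tau>; y \<boxplus> x = \<tau>;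
        x \<boxplus> (y \<ominus> (\<tau> \<ominus> z)) = \<tau>\<rbrakk>
      \<Longrightarrow> z \<boxplus> (y \<ominus> (\<tau> \<ominus> x)) = \<tau>"
    and assoc_6: "\<lbrakk>x \<in> T; y \<in> T; z \<in> T; y \<boxplus> z = \<tau>; y \<boxplus> x = \<tau>;
        x \<boxplus> (y \<ominus> (\<tau> \<ominus> z)) = \<tau>\<rbrakk>
      \<Longrightarrow> (y \<ominus> (\<tau> \<ominus> x)) \<ominus> (\<tau> \<ominus> z) = (y \<ominus> (\<tau> \<ominus> z)) \<ominus> (\<tau> \<ominus> x)"

text \<open>
  The group is in the multiplicative notation of \<^locale>\<open>comm_group\<close>: its operation is
  \<open>\<otimes>\<close> and its neutral element, the zero of the ordered group, is \<open>\<one>\<close>.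
\<close>

locale ordered_comm_group = comm_group G for G (structure) +
  fixes R :: "('a \<times> 'a) set"
  assumes linear: "linear_order_on (carrier G) R"
    and mult_left_mono:
      "\<lbrakk>x \<in> carrier G; y \<in> carrier G; z \<in> carrier G; (x, y) \<in> R\<rbrakk> \<Longrightarrow> (z \<otimes> x, z \<otimes> y) \<in> R"

definition nonneg :: "('a, 'm) monoid_scheme \<Rightarrow> ('a \<times> 'a) set \<Rightarrow> 'a set"
  where "nonneg G R = {g \<in> carrier G. (\<one>\<^bsub>G\<^esub>, g) \<in> R}"

definition initial_segment :: "('a, 'm) monoid_scheme \<Rightarrow> ('a \<times> 'a) set \<Rightarrow> 'a \<Rightarrow> 'a set"
  where "initial_segment G R t = {g \<in> nonneg G R. (g, t) \<in> R}"

text \<open>The minimum of \<open>a \<otimes> b\<close> and \<open>t\<close> with respect to \<open>R\<close>.\<close>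

definition trunc_add :: "('a, 'm) monoid_scheme \<Rightarrow> ('a \<times> 'a) set \<Rightarrow> 'a \<Rightarrow> 'a \<Rightarrow> 'a \<Rightarrow> 'a"
  where "trunc_add G R t a b = (if (a \<otimes>\<^bsub>G\<^esub> b, t) \<in> R then a \<otimes>\<^bsub>G\<^esub> b else t)"

text \<open>
  Only the elements of the carriers matter, so the relations may live on larger sets.
\<close>

definition ordered_add_iso ::
    "'a set \<Rightarrow> ('a \<times> 'a) set \<Rightarrow> ('a \<Rightarrow> 'a \<Rightarrow> 'a)
      \<Rightarrow> 'b set \<Rightarrow> ('b \<times> 'b) set \<Rightarrow> ('b \<Rightarrow> 'b \<Rightarrow> 'b) \<Rightarrow> ('a \<Rightarrow> 'b) \<Rightarrow> bool"
  where "ordered_add_iso T R add T' R' add' f \<longleftrightarrow>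
    bij_betw f T T' \<and>
    (\<forall>x\<in>T. \<forall>y\<in>T. (x, y) \<in> R \<longleftrightarrow> (f x, f y) \<in> R') \<and>
    (\<forall>x\<in>T. \<forall>y\<in>T. f (add x y) = add' (f x) (f y))"

end

theory Submission
  imports Defs
begin

text \<open>
  Every element of the desired group is uniquely \<open>m\<tau> + x\<close> with \<open>m\<close> an integer and
  \<open>\<zero> \<preceq> x \<prec> \<tau>\<close>. So the group is \<open>\<int> \<times> [\<zero>, \<tau>)\<close>, ordered lexicographically, with addition
  with carry: if \<open>x \<boxplus> y = \<tau>\<close> then one \<open>\<tau>\<close> is carried and the remainder is
  \<open>y \<ominus> (\<tau> \<ominus> x)\<close>. Commutativity of the remainder is \<open>diff_commute\<close>, and
  the axioms \<open>assoc_1\<close> to \<open>assoc_6\<close> are associativity, split according to which of the sums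
  reach \<open>\<tau>\<close>. If \<open>\<tau> = \<zero>\<close>, the interval \<open>[\<zero>, \<tau>)\<close> is empty and the trivial group is used.
\<close>

context toag
begin

section \<open>Residues, carries and the group built from them\<close>

definition below_tau :: "'a set"
  where "below_tau = T - {\<tau>}"

definition carry :: "'a \<Rightarrow> 'a \<Rightarrow> int"
  where "carry x y = (if x \<boxplus> y = \<tau> then 1 else 0)"

text \<open>In the group being built, the carried value is x + y - \<tau>. It is written as y -
  (\<tau> - x) because the truncated sum has lost its excess over \<tau>.\<close>

definition remainder :: "'a \<Rightarrow> 'a \<Rightarrow> 'a"
  where "remainder x y = (if x \<boxplus> y = \<tau> then y \<ominus> (\<tau> \<ominus> x) else x \<boxplus> y)"

definition carry_group :: "(int \<times> 'a) monoid"
  where "carry_group =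
    \<lparr>carrier = UNIV \<times> below_tau,
     monoid.mult = (\<lambda>g h. (fst g + fst h + carry (snd g) (snd h), remainder (snd g) (snd h))),
     one = (0, \<zero>)\<rparr>"

text \<open>The membership conditions keep the relation inside the carrier, as
  \<open>linear_order_on\<close> demands.\<close>

definition lex_order :: "((int \<times> 'a) \<times> (int \<times> 'a)) set"
  where "lex_order = {(g, h). snd g \<in> below_tau \<and> snd h \<in> below_tau \<and>
    (fst g < fst h \<or> fst g = fst h \<and> snd g \<preceq> snd h)}"

text \<open>The top element is no residue, so it is represented as one full \<tau> with residue
  \<open>\<zero>\<close>.\<close>

definition embed :: "'a \<Rightarrow> int \<times> 'a"
  where "embed x = (if x = \<tau> then (1, \<zero>) else (0, x))"

lemma below_tauD: "x \<in> below_tau \<Longrightarrow> x \<in> T" "x \<in> below_tau \<Longrightarrow> x \<noteq> \<tau>"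
  by (auto simp: below_tau_def)

lemma below_tauI: "x \<in> T \<Longrightarrow> x \<noteq> \<tau> \<Longrightarrow> x \<in> below_tau"
  by (auto simp: below_tau_def)

section \<open>Order and differences in the interval\<close>

lemma le_refl: "x \<in> T \<Longrightarrow> x \<preceq> x"
  using linear by (auto simp: order_on_defs refl_on_def)

lemma le_antisym: "x \<preceq> y \<Longrightarrow> y \<preceq> x \<Longrightarrow> x = y"
  using linear by (auto simp: order_on_defs antisym_def)

lemma le_trans: "x \<preceq> y \<Longrightarrow> y \<preceq> z \<Longrightarrow> x \<preceq> z"
  using linear by (auto simp: order_on_defs intro: transD)

lemma le_total: "x \<in> T \<Longrightarrow> y \<in> T \<Longrightarrow> x \<preceq> y \<or> y \<preceq> x"
  using linear le_refl by (cases "x = y") (auto simp: order_on_defs total_on_def)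

lemma le_zero_iff: "x \<in> T \<Longrightarrow> x \<preceq> \<zero> \<longleftrightarrow> x = \<zero>"
  using le_antisym le_refl zero_least by metis

lemma tau_le_iff: "x \<in> T \<Longrightarrow> \<tau> \<preceq> x \<longleftrightarrow> x = \<tau>"
  using le_antisym le_refl tau_greatest by metis

lemma zero_add: "x \<in> T \<Longrightarrow> \<zero> \<boxplus> x = x"
  by (metis add_commute add_zero zero_closed)

lemma le_add: "x \<in> T \<Longrightarrow> y \<in> T \<Longrightarrow> x \<preceq> x \<boxplus> y"
  by (metis add_mono add_zero le_refl zero_closed zero_least)

lemma tau_diff:
  assumes "x \<in> T"
  shows "\<tau> \<ominus> x \<in> T" and "x \<boxplus> (\<tau> \<ominus> x) = \<tau>"
    and "w \<in> T \<Longrightarrow> x \<boxplus> w = \<tau> \<Longrightarrow> \<tau> \<ominus> x \<preceq> w"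
proof -
  let ?P = "\<lambda>z. z \<in> T \<and> x \<boxplus> z = \<tau> \<and> (\<forall>w\<in>T. x \<boxplus> w = \<tau> \<longrightarrow> z \<preceq> w)"
  have "\<exists>!z. ?P z"
    using diff_tau_least[OF assms] le_antisym by blast
  from theI'[OF this] have "?P (\<tau> \<ominus> x)"
    by (simp add: diff_def)
  then show "\<tau> \<ominus> x \<in> T" "x \<boxplus> (\<tau> \<ominus> x) = \<tau>" "w \<in> T \<Longrightarrow> x \<boxplus> w = \<tau> \<Longrightarrow> \<tau> \<ominus> x \<preceq> w"
    by auto
qed

lemma diff_below:
  assumes "x \<in> T" "y \<in> below_tau" "x \<preceq> y"
  shows "y \<ominus> x \<in> below_tau" and "x \<boxplus> (y \<ominus> x) = y"
proof -
  have y: "y \<in> T" "y \<noteq> \<tau>" "y \<prec> \<tau>"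
    using assms(2) below_tauD tau_greatest by auto
  have "y \<ominus> x \<in> T \<and> x \<boxplus> (y \<ominus> x) = y"
    using theI'[OF diff_unique[OF assms(1) y(1) assms(3) y(3)]] y(2) by (simp add: diff_def)
  \<comment> \<open>The difference is not \<tau>, since adding \<tau> to \<open>x\<close> would give
    \<tau> and not \<open>y\<close>.\<close>
  then show "y \<ominus> x \<in> below_tau" "x \<boxplus> (y \<ominus> x) = y"
    using y(2) add_tau[OF assms(1)] by (auto intro!: below_tauI)
qed

text \<open>As \<open>y\<close> solves \<open>x \<boxplus> w = \<tau>\<close> and
  \<open>\<tau> \<ominus> x\<close> is the least solution, \<open>\<tau> \<ominus> x\<close> is at
  most \<open>y\<close> and can be subtracted from it.\<close>

lemma remainder_carried:
  assumes "x \<in> T" "y \<in> below_tau" "x \<boxplus> y = \<tau>"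
  shows "y \<ominus> (\<tau> \<ominus> x) \<in> below_tau" and "(\<tau> \<ominus> x) \<boxplus> (y \<ominus> (\<tau> \<ominus> x)) = y"
  using assms diff_below[OF tau_diff(1)] tau_diff(3) below_tauD by auto

section \<open>Closure, commutativity and associativity of addition with carry\<close>

lemma remainder_closed:
  assumes "x \<in> below_tau" "y \<in> below_tau"
  shows "remainder x y \<in> below_tau"
  using assms remainder_carried(1) add_closed below_tauD
  by (auto simp: remainder_def intro!: below_tauI)

lemma carry_commute: "x \<in> below_tau \<Longrightarrow> y \<in> below_tau \<Longrightarrow> carry x y = carry y x"
  by (simp add: carry_def add_commute below_tauD)

lemma remainder_commute:
  assumes "x \<in> below_tau" "y \<in> below_tau"
  shows "remainder x y = remainder y x"
  using assms diff_commute[of x y] add_commute[of x y] tau_greatest below_tauD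
  by (simp add: remainder_def)

text \<open>The conjuncts are associativity in the integer part and in the residue. Only the total
  of the carries is compared: one bracketing may carry in its inner sum and the other in its outer
  sum.\<close>

lemma remainder_assoc:
  assumes "x \<in> below_tau" "y \<in> below_tau" "z \<in> below_tau"
  shows "carry x y + carry (remainder x y) z = carry y z + carry x (remainder y z) \<and>
    remainder (remainder x y) z = remainder x (remainder y z)"
proof -
  note lt = tau_greatest below_tauD
  \<comment> \<open>Stated for fresh variables because the mirrored case uses it with
    \<open>x\<close> and \<open>z\<close> exchanged.\<close>
  have one_carry: "carry x y + carry (remainder x y) z = carry y z + carry x (remainder y z) \<and>
    remainder (remainder x y) z = remainder x (remainder y z)"
    if x: "x \<in> below_tau" and y: "y \<in> below_tau" and z: "z \<in> below_tau"
      and xy: "x \<boxplus> y = \<tau>" and yz: "y \<boxplus> z \<noteq> \<tau>" for x y z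
  proof -
    have T: "x \<in> T" "y \<in> T" "z \<in> T" using x y z below_tauD by auto
    have yzM: "y \<boxplus> z \<in> below_tau" using T yz by (simp add: add_closed below_tauI)
    have yx: "y \<boxplus> x = \<tau>" using xy T add_commute by metis
    have xyz: "x \<boxplus> (y \<boxplus> z) = \<tau>" "x \<boxplus> y \<boxplus> z = \<tau>"
      using add_assoc[OF T] xy add_commute[of \<tau> z] add_tau T tau_closed by auto
    let ?r = "y \<ominus> (\<tau> \<ominus> x)"
    have r: "?r \<in> T" using remainder_carried(1)[OF T(1) y xy] below_tauD by auto
    \<comment> \<open>\<open>assoc_3\<close> excludes a second carry in the left bracketing. The
      right one carries only in its outer sum, so the totals agree.\<close>
    have zr: "z \<boxplus> ?r \<prec> \<tau>"
      using assoc_3[OF T yx] yz yzM lt by auto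
    have eq: "z \<boxplus> ?r = x \<ominus> (\<tau> \<ominus> (y \<boxplus> z))"
      using assoc_2[OF T _ xyz(2) yx zr] yzM lt by auto
    \<comment> \<open>\<open>remainder\<close> subtracts from its second argument, so
      \<open>x\<close> first appears there and is then moved by commutativity.\<close>
    also have "\<dots> = remainder (y \<boxplus> z) x"
      using xyz(1) yzM T add_commute[of "y \<boxplus> z" x] below_tauD by (auto simp: remainder_def)
    also have "\<dots> = remainder x (y \<boxplus> z)"
      by (rule remainder_commute[OF yzM x])
    finally show ?thesis
      using zr xy yz xyz add_commute[OF T(3) r]
      by (simp add: carry_def remainder_def)
  qed
  have T: "x \<in> T" "y \<in> T" "z \<in> T" using assms below_tauD by auto
  consider (none) "x \<boxplus> y \<noteq> \<tau>" "y \<boxplus> z \<noteq> \<tau>" | (left) "x \<boxplus> y = \<tau>" "y \<boxplus> z \<noteq> \<tau>"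
    | (right) "x \<boxplus> y \<noteq> \<tau>" "y \<boxplus> z = \<tau>" | (both) "x \<boxplus> y = \<tau>" "y \<boxplus> z = \<tau>"
    by blast
  then show ?thesis
  proof cases
    case none
    have M: "x \<boxplus> y \<in> below_tau" "y \<boxplus> z \<in> below_tau"
      using none T by (simp_all add: add_closed below_tauI)
    show ?thesis
    proof (cases "x \<boxplus> (y \<boxplus> z) = \<tau>")
      case False
      then show ?thesis
        using none add_assoc[OF T] by (simp add: carry_def remainder_def)
    next
      case True
      \<comment> \<open>Both outer sums carry, and \<open>assoc_1\<close> compares their
        remainders.\<close>
      have "remainder (x \<boxplus> y) z = z \<ominus> (\<tau> \<ominus> (x \<boxplus> y))"
        using True add_assoc[OF T] by (simp add: remainder_def)
      also have "\<dots> = x \<ominus> (\<tau> \<ominus> (y \<boxplus> z))"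
        using assoc_1[OF T _ True] M add_commute[OF T(2,1)] lt by auto
      also have "\<dots> = remainder (y \<boxplus> z) x"
        using True add_commute[OF T(1) below_tauD(1)[OF M(2)]] by (simp add: remainder_def)
      also have "\<dots> = remainder x (y \<boxplus> z)"
        by (rule remainder_commute[OF M(2) assms(1)])
      finally show ?thesis
        using none True add_assoc[OF T] by (simp add: carry_def remainder_def)
    qed
  next
    case left
    then show ?thesis using one_carry assms by blast
  next
    case right
    \<comment> \<open>The mirror image of the previous case: reverse the triple, then undo the
      reversal by commutativity.\<close>
    then have "z \<boxplus> y = \<tau>" "y \<boxplus> x \<noteq> \<tau>"
      using T add_commute by metis+
    then show ?thesis
      using one_carry[OF assms(3,2,1)] assms carry_commute remainder_commute remainder_closed
      by metis
  next
    case both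
    have sw: "z \<boxplus> y = \<tau>" "y \<boxplus> x = \<tau>"
      using both T add_commute by metis+
    \<comment> \<open>Both remainders are written as differences from \<open>y\<close>, the form
      used in the axioms; the second is literally \<open>remainder z y\<close>.\<close>
    let ?r = "y \<ominus> (\<tau> \<ominus> x)" and ?s = "y \<ominus> (\<tau> \<ominus> z)"
    have rs: "remainder x y = ?r" "remainder y z = ?s"
      using both sw remainder_commute[OF assms(2,3)] by (simp_all add: remainder_def)
    have M: "?r \<in> below_tau" "?s \<in> below_tau"
      using remainder_closed assms rs by metis+
    have rz: "?r \<boxplus> z = z \<boxplus> ?r"
      using add_commute T M below_tauD by auto
    show ?thesis
    \<comment> \<open>\<open>assoc_5\<close>, used also with \<open>x\<close> and \<open>z\<close>
      exchanged, shows that a second carry occurs in one bracketing exactly when it occurs in the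
      other. The residues then agree by \<open>assoc_6\<close> or \<open>assoc_4\<close>.\<close>
    proof (cases "z \<boxplus> ?r = \<tau>")
      case True
      have xs: "x \<boxplus> ?s = \<tau>"
        using assoc_5[OF T(3,2,1) sw(2) both(2) True] .
      have "remainder ?r z = remainder z ?r"
        using remainder_commute M assms by blast
      also have "\<dots> = ?r \<ominus> (\<tau> \<ominus> z)"
        using True by (simp add: remainder_def)
      also have "\<dots> = ?s \<ominus> (\<tau> \<ominus> x)"
        by (rule assoc_6[OF T both(2) sw(2) xs])
      finally show ?thesis
        unfolding rs using both True xs rz by (simp add: carry_def remainder_def)
    next
      case False
      have xs: "x \<boxplus> ?s \<noteq> \<tau>"
        using assoc_5[OF T both(2) sw(2)] False by blast
      have "x \<boxplus> ?s = (x \<ominus> (\<tau> \<ominus> y)) \<boxplus> z"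
        using assoc_4[OF T both(2) sw(2)] False T M add_closed lt by auto
      also have "x \<ominus> (\<tau> \<ominus> y) = ?r"
        using diff_commute[OF T(1,2) _ _ both(1)] assms lt by auto
      finally show ?thesis
        unfolding rs using both xs False rz by (simp add: carry_def remainder_def)
    qed
  qed
qed

section \<open>Compatibility of carries and remainders with the order\<close>

text \<open>This is translation by \<open>z\<close> when the integer parts are equal. A carry for
  the smaller summand forces one for the larger, and subtracting the same
  \<open>\<tau> \<ominus> z\<close> preserves the order.\<close>

lemma remainder_mono:
  assumes "x \<in> below_tau" "y \<in> below_tau" "z \<in> below_tau" "x \<preceq> y"
  shows "carry z x < carry z y \<or> carry z x = carry z y \<and> remainder z x \<preceq> remainder z y"
proof -
  have T: "x \<in> T" "y \<in> T" "z \<in> T" using assms below_tauD by auto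
  have le: "z \<boxplus> x \<preceq> z \<boxplus> y"
    using add_mono T le_refl assms(4) by blast
  show ?thesis
  proof (cases "z \<boxplus> x = \<tau>")
    case False
    then show ?thesis using le by (simp add: carry_def remainder_def)
  next
    case True
    then have zy: "z \<boxplus> y = \<tau>"
      using le tau_greatest le_antisym add_closed T by metis
    let ?d = "\<tau> \<ominus> z"
    have d: "?d \<in> T" by (rule tau_diff(1)[OF T(3)])
    note rx = remainder_carried[OF T(3) assms(1) True]
      and ry = remainder_carried[OF T(3) assms(2) zy]
    have "x \<ominus> ?d \<preceq> y \<ominus> ?d"
    proof (rule ccontr)
      assume *: "\<not> ?thesis"
      then have "y \<ominus> ?d \<preceq> x \<ominus> ?d"
        using le_total rx(1) ry(1) below_tauD by metis
      \<comment> \<open>Adding \<open>?d\<close> back to both remainders recovers \<open>y\<close>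
        and \<open>x\<close>.\<close>
      then have "y \<preceq> x"
        using add_mono[OF d d _ _ le_refl[OF d]] rx ry below_tauD by metis
      then have "x = y" using assms(4) le_antisym by blast
      with * show False using le_refl rx(1) below_tauD by blast
    qed
    then show ?thesis using True zy by (simp add: carry_def remainder_def)
  qed
qed

text \<open>Adding \<open>\<tau> \<ominus> y\<close> to the remainder gives back \<open>x\<close>,
  and adding an element never decreases.\<close>

lemma remainder_le:
  assumes "x \<in> below_tau" "y \<in> below_tau" "x \<boxplus> y = \<tau>"
  shows "remainder x y \<preceq> x"
proof -
  have T: "x \<in> T" "y \<in> T" using assms below_tauD by auto
  have yx: "y \<boxplus> x = \<tau>" using assms(3) add_commute T by metis
  note r = remainder_carried[OF T(2) assms(1) yx]
  have "(x \<ominus> (\<tau> \<ominus> y)) \<boxplus> (\<tau> \<ominus> y) = x"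
    using r add_commute tau_diff(1) T below_tauD by metis
  then have "x \<ominus> (\<tau> \<ominus> y) \<preceq> x"
    using le_add[OF below_tauD(1)[OF r(1)] tau_diff(1)[OF T(2)]] by simp
  then show ?thesis
    using remainder_commute[OF assms(1,2)] yx by (simp add: remainder_def)
qed

section \<open>Neutral element, inverses and the ordered group\<close>

lemma tau_diff_zero: "\<tau> \<ominus> \<tau> = \<zero>"
  by (metis add_commute add_tau le_antisym tau_closed tau_diff zero_closed zero_least)

lemma zero_carry:
  assumes "x \<in> below_tau"
  shows "carry \<zero> x = 0" and "remainder \<zero> x = x"
  using assms zero_add below_tauD by (auto simp: carry_def remainder_def)

lemma remainder_inverse:
  assumes "x \<in> below_tau" "x \<noteq> \<zero>"
  shows "\<tau> \<ominus> x \<in> below_tau" and "carry (\<tau> \<ominus> x) x = 1" and "remainder (\<tau> \<ominus> x) x = \<zero>"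
proof -
  have x: "x \<in> T" using assms below_tauD by auto
  \<comment> \<open>If \<open>\<tau> \<ominus> x\<close> were \<tau>, then
    \<open>diff_tau_invol\<close> would give
    \<open>x = \<tau> \<ominus> \<tau> = \<zero>\<close>.\<close>
  show M: "\<tau> \<ominus> x \<in> below_tau"
    using tau_diff(1)[OF x] diff_tau_invol[OF x] tau_diff_zero assms(2)
    by (auto intro!: below_tauI)
  have eq: "(\<tau> \<ominus> x) \<boxplus> x = \<tau>"
    using tau_diff(1,2)[OF x] add_commute x by metis
  then show "carry (\<tau> \<ominus> x) x = 1" by (simp add: carry_def)
  have r: "x \<ominus> x \<in> T" "x \<boxplus> (x \<ominus> x) = x"
    using diff_below[OF x assms(1) le_refl[OF x]] below_tauD by auto
  have "x \<ominus> x = \<zero>"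
    using add_cancel[OF x r(1) zero_closed] r(2) add_zero[OF x] x assms(1) tau_greatest below_tauD
    by auto
  \<comment> \<open>By the involution, \<tau> minus \<open>\<tau> \<ominus> x\<close> is
    \<open>x\<close>, so the remainder is \<open>x \<ominus> x\<close>.\<close>
  then show "remainder (\<tau> \<ominus> x) x = \<zero>"
    using eq diff_tau_invol[OF x] by (simp add: remainder_def)
qed

lemma zero_below_tau: "\<zero> \<noteq> \<tau> \<Longrightarrow> \<zero> \<in> below_tau"
  by (rule below_tauI[OF zero_closed])

lemma comm_group_carry_group:
  assumes "\<zero> \<noteq> \<tau>"
  shows "comm_group carry_group"
proof (rule comm_groupI)
  note z = zero_below_tau[OF assms]
  show "\<one>\<^bsub>carry_group\<^esub> \<in> carrier carry_group"
    using z by (simp add: carry_group_def)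
  fix g assume g: "g \<in> carrier carry_group"
  then show "\<one>\<^bsub>carry_group\<^esub> \<otimes>\<^bsub>carry_group\<^esub> g = g"
    by (auto simp: carry_group_def zero_carry)
  obtain m x where gx: "g = (m, x)" "x \<in> below_tau"
    using g by (auto simp: carry_group_def)
  show "\<exists>h\<in>carrier carry_group. h \<otimes>\<^bsub>carry_group\<^esub> g = \<one>\<^bsub>carry_group\<^esub>"
  proof (cases "x = \<zero>")
    case True
    then show ?thesis
      using z gx zero_carry[OF z]
      by (intro bexI[of _ "(- m, \<zero>)"]) (auto simp: carry_group_def)
  next
    case False
    \<comment> \<open>The residues add up to exactly one \<tau>; the extra -1 in the integer part
      absorbs this carry.\<close>
    then show ?thesis
      using gx remainder_inverse[OF gx(2)]
      by (intro bexI[of _ "(- m - 1, \<tau> \<ominus> x)"]) (auto simp: carry_group_def)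
  qed
next
  fix g h k assume "g \<in> carrier carry_group" "h \<in> carrier carry_group" "k \<in> carrier carry_group"
  then have M: "snd g \<in> below_tau" "snd h \<in> below_tau" "snd k \<in> below_tau"
    by (auto simp: carry_group_def)
  show "g \<otimes>\<^bsub>carry_group\<^esub> h \<otimes>\<^bsub>carry_group\<^esub> k = g \<otimes>\<^bsub>carry_group\<^esub> (h \<otimes>\<^bsub>carry_group\<^esub> k)"
    using remainder_assoc[OF M] by (simp add: carry_group_def)
next
  fix g h assume "g \<in> carrier carry_group" "h \<in> carrier carry_group"
  then have M: "snd g \<in> below_tau" "snd h \<in> below_tau"
    by (auto simp: carry_group_def)
  show "g \<otimes>\<^bsub>carry_group\<^esub> h \<in> carrier carry_group"
    using remainder_closed[OF M] by (simp add: carry_group_def)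
  show "g \<otimes>\<^bsub>carry_group\<^esub> h = h \<otimes>\<^bsub>carry_group\<^esub> g"
    using carry_commute[OF M] remainder_commute[OF M] by (simp add: carry_group_def)
qed

lemma linear_order_lex_order: "linear_order_on (UNIV \<times> below_tau) lex_order"
  unfolding order_on_defs
proof (intro conjI)
  show "lex_order \<subseteq> (UNIV \<times> below_tau) \<times> (UNIV \<times> below_tau)"
    by (auto simp: lex_order_def)
  show "refl_on (UNIV \<times> below_tau) lex_order"
    by (auto simp: refl_on_def lex_order_def le_refl below_tauD)
  show "trans lex_order"
    by (rule transI) (auto simp: lex_order_def intro: le_trans)
  show "antisym lex_order"
    by (rule antisymI) (auto simp: lex_order_def intro: le_antisym)
  show "total_on (UNIV \<times> below_tau) lex_order"
    using le_total[OF below_tauD(1) below_tauD(1)]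
    by (auto simp: total_on_def lex_order_def)
qed

lemma lex_order_mono:
  assumes "snd k \<in> below_tau" "(g, h) \<in> lex_order"
  shows "(k \<otimes>\<^bsub>carry_group\<^esub> g, k \<otimes>\<^bsub>carry_group\<^esub> h) \<in> lex_order"
proof -
  obtain p z m x n y where [simp]: "k = (p, z)" "g = (m, x)" "h = (n, y)"
    by (metis surj_pair)
  have M: "x \<in> below_tau" "y \<in> below_tau" "z \<in> below_tau"
    and le: "m < n \<or> m = n \<and> x \<preceq> y"
    using assms by (auto simp: lex_order_def)
  have T: "x \<in> T" "y \<in> T" "z \<in> T" using M below_tauD by auto
  have C: "remainder z x \<in> below_tau" "remainder z y \<in> below_tau"
    using remainder_closed M by auto
  have "m + carry z x < n + carry z y \<or>
      m + carry z x = n + carry z y \<and> remainder z x \<preceq> remainder z y"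
    using le
  proof
    assume "m = n \<and> x \<preceq> y"
    then show ?thesis using remainder_mono M by auto
  next
    assume "m < n"
    \<comment> \<open>Carries are 0 or 1, so a strict inequality of integer parts can at worst
      become an equality, and only if \<open>x\<close> causes a carry and \<open>y\<close> does not.
      Then the residues are separated by \<open>z\<close>.\<close>
    moreover have "remainder z x \<preceq> remainder z y" if "z \<boxplus> x = \<tau>" "z \<boxplus> y \<noteq> \<tau>"
    proof -
      have "remainder z x \<preceq> z \<boxplus> y"
        using remainder_le[OF M(3,1) that(1)] le_add[OF T(3,2)] by (rule le_trans)
      then show ?thesis using that by (simp add: remainder_def)
    qed
    ultimately show ?thesis by (auto simp: carry_def)
  qed
  then show ?thesis using C by (auto simp: carry_group_def lex_order_def)
qed

lemma ordered_comm_group_carry_group: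
  assumes "\<zero> \<noteq> \<tau>"
  shows "ordered_comm_group carry_group lex_order"
proof -
  interpret comm_group carry_group by (rule comm_group_carry_group[OF assms])
  show ?thesis
    by unfold_locales
      (use linear_order_lex_order lex_order_mono in \<open>auto simp: carry_group_def\<close>)
qed

section \<open>The initial segment and the isomorphism\<close>

text \<open>The bounds leave only integer parts 0 and 1, and over 1 the residue must be at most
  \<open>\<zero>\<close>.\<close>

lemma initial_segment_carry_group:
  assumes "\<zero> \<noteq> \<tau>"
  shows "initial_segment carry_group lex_order (1, \<zero>) = insert (1, \<zero>) ({0} \<times> below_tau)"
  using zero_below_tau[OF assms] zero_least
  by (auto simp: initial_segment_def nonneg_def carry_group_def lex_order_def le_zero_iff
      below_tauD le_refl)

lemma ordered_add_iso_embed: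
  assumes "\<zero> \<noteq> \<tau>"
  shows "ordered_add_iso T R add (initial_segment carry_group lex_order (1, \<zero>)) lex_order
    (trunc_add carry_group lex_order (1, \<zero>)) embed"
  unfolding ordered_add_iso_def initial_segment_carry_group[OF assms]
proof (intro conjI ballI)
  note z = zero_below_tau[OF assms]
  show "bij_betw embed T (insert (1, \<zero>) ({0} \<times> below_tau))"
    unfolding bij_betw_def
    using tau_closed by (auto simp: inj_on_def embed_def below_tau_def image_iff split: if_splits)
  fix x y assume T: "x \<in> T" "y \<in> T"
  show "x \<preceq> y \<longleftrightarrow> (embed x, embed y) \<in> lex_order"
    using T z by (auto simp: embed_def lex_order_def tau_greatest tau_le_iff le_refl zero_closed
        intro: below_tauI)
  show "embed (x \<boxplus> y) = trunc_add carry_group lex_order (1, \<zero>) (embed x) (embed y)"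
  proof (cases "x = \<tau> \<or> y = \<tau>")
    case True
    then have "x \<boxplus> y = \<tau>"
      using T add_tau add_commute by metis
    \<comment> \<open>One summand is already the bound \<open>(1, \<zero>)\<close>, so the sum is at
      least the bound and truncates to it.\<close>
    then show ?thesis
      using T True z assms zero_carry zero_closed
      by (auto simp: embed_def trunc_add_def carry_group_def lex_order_def carry_def
          remainder_def add_zero zero_add le_zero_iff)
  next
    case False
    then have M: "x \<in> below_tau" "y \<in> below_tau" using T below_tauI by auto
    have r: "remainder x y \<in> below_tau" by (rule remainder_closed[OF M])
    show ?thesis
    proof (cases "x \<boxplus> y = \<tau>")
      case True
      \<comment> \<open>The group sum has integer part 1, so truncation discards its
        residue.\<close>
      then show ?thesis
        using False r
        by (auto simp: embed_def trunc_add_def carry_group_def lex_order_def carry_def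
            le_zero_iff below_tauD)
    next
      case sum: False
      then show ?thesis
        using False r z
        by (auto simp: embed_def trunc_add_def carry_group_def lex_order_def carry_def
            remainder_def)
    qed
  qed
qed

end

section \<open>The degenerate interval and the conclusion\<close>

lemma ordered_comm_group_trivial:
  "ordered_comm_group \<lparr>carrier = {e}, monoid.mult = (\<lambda>_ _. e), one = e\<rparr> {(e, e)}"
proof -
  let ?G = "\<lparr>carrier = {e}, monoid.mult = (\<lambda>_ _. e), one = e\<rparr>"
  interpret comm_group ?G
    by (rule comm_groupI) auto
  show ?thesis
    by unfold_locales (auto simp: order_on_defs refl_on_def trans_def antisym_def)
qed

theorem theorem1:
  fixes T :: "'a set"
    and R :: "('a \<times> 'a) set"
    and add :: "'a \<Rightarrow> 'a \<Rightarrow> 'a"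
    and zero tau :: 'a
  assumes "toag T R add zero tau"
  shows "\<exists>(G :: (int \<times> 'a) monoid) S tauP.
    ordered_comm_group G S \<and>
    tauP \<in> nonneg G S \<and>
    (\<exists>f. ordered_add_iso T R add
           (initial_segment G S tauP) S (trunc_add G S tauP) f)"
proof -
  interpret toag T R add zero tau by (rule assms)
  show ?thesis
  proof (cases "zero = tau")
    case True
    \<comment> \<open>The type of the group is fixed by the statement, so the trivial group sits on
      a single point of \<open>int \<times> 'a\<close>; any point would serve.\<close>
    define e where "e = (0 :: int, zero)"
    let ?G = "\<lparr>carrier = {e}, monoid.mult = (\<lambda>_ _. e), one = e\<rparr>"
    have T: "T = {zero}"
      using True zero_least tau_greatest le_antisym zero_closed by blast
    have seg: "initial_segment ?G {(e, e)} e = {e}"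
      by (auto simp: initial_segment_def nonneg_def)
    have "ordered_add_iso T R add (initial_segment ?G {(e, e)} e) {(e, e)}
        (trunc_add ?G {(e, e)} e) (\<lambda>_. e)"
      unfolding ordered_add_iso_def seg T
      using le_refl[OF zero_closed] by (auto simp: bij_betw_def trunc_add_def)
    moreover have "e \<in> nonneg ?G {(e, e)}"
      by (simp add: nonneg_def)
    ultimately show ?thesis
      using ordered_comm_group_trivial[of e] by blast
  next
    case False
    have "(1, zero) \<in> nonneg carry_group lex_order"
      using zero_below_tau[OF False] by (simp add: nonneg_def carry_group_def lex_order_def)
    then show ?thesis
      using ordered_comm_group_carry_group[OF False] ordered_add_iso_embed[OF False] by blast
  qed
qed

end
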